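(* Let $\boldsymbol{v}_{\mathrm{u}}(\cdot)=(v_{\mathrm{u},1}(\cdot),\dots,v_{\mathrm{u},d_v}(\cdot))$ be an $\mathbb{R}^{d_v}$-valued function of the state $\boldsymbol{z}$ that is a sample from a vector-valued Gaussian process with posterior mean $\bar{\boldsymbol{v}}_{\mathrm{u}}(\boldsymbol{z})=(\bar v_{\mathrm{u},1}(\boldsymbol{z}),\dots,\bar v_{\mathrm{u},d_v}(\boldsymbol{z}))$ and posterior variance $\sigma_{\mathrm{u}}^2(\boldsymbol{z})$, with entries $\sigma_{\mathrm{u},i}^2(\boldsymbol{z})$, $i=1,\dots,d_v$; here $\sigma_{\mathrm{u},i}(\boldsymbol{z})\ge 0$ denotes the posterior standard deviation of the $i$-th entry of the Gaussian process used to model $\boldsymbol{v}_{\mathrm{u}}$. Consider a least-squares projection with nonlinear constraints $\boldsymbol{g}=\boldsymbol{0}$ of the form $$\boldsymbol{v}(\boldsymbol{v}_{\mathrm{u}})=\underset{\boldsymbol{\nu}}{\mathrm{argmin}}\ \lVert\boldsymbol{\nu}-\boldsymbol{v}_{\mathrm{u}}\rVert^2\quad\text{s.t.}\quad \boldsymbol{g}(\boldsymbol{\nu})=\boldsymbol{0}.$$ Assume that this projection corresponds to a Lipschitz continuous function $\boldsymbol{v}(\cdot)$ with Lipschitz constant $L$. Then for every $\delta\in(0,1)$ there exists a $\gamma>0$ such that $$\bigl\lVert \boldsymbol{v}(\boldsymbol{v}_{\mathrm{u}}(\boldsymbol{z}))-\boldsymbol{v}(\bar{\boldsymbol{v}}_{\mathrm{u}}(\boldsymbol{z}))\bigr\rVert<\sum_{i=1}^{d_v}\gamma\,\sigma_{\mathrm{u},i}(\boldsymbol{z})$$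 holds for all states $\boldsymbol{z}$ with a probability of at least $1-\delta$.
   Context: $\lVert\cdot\rVert$ is the Euclidean norm, $d_v$ is the dimension of $\boldsymbol{v}_{\mathrm{u}}$, $\boldsymbol{\nu}$ ranges over $\mathbb{R}^{d_v}$, and $\boldsymbol{g}$ is a vector-valued constraint function with values in $\mathbb{R}^c$. States are $\boldsymbol{z}=[\boldsymbol{x}^{\mathrm T}\ \boldsymbol{v}^{\mathrm T}]^{\mathrm T}$ with generalized position $\boldsymbol{x}\in\mathbb{R}^n$ and generalized velocity $\boldsymbol{v}\in\mathbb{R}^n$ of a mechanical system. A Gaussian process (GP) is a collection of random variables, indexed here by states $\boldsymbol{z}$, any finite subset of which is jointly normally distributed; it is specified by its mean function and covariance function. A vector-valued GP means a vector of independent scalar GPs, one for each entry. Posterior of a scalar GP with prior mean $\bar m(\cdot)$ and covariance function $k(\cdot,\cdot)$, conditioned on data $(\boldsymbol{Z},\boldsymbol{y})=(\boldsymbol{z}_i,f(\boldsymbol{z}_i))_{i=1,\dots,N}$: the posterior mean and variance are $$\mu(\boldsymbol{z})=\bar m(\boldsymbol{z})+\boldsymbol{k}(\boldsymbol{z},\boldsymbol{Z})\boldsymbol{K}(\boldsymbol{Z},\boldsymbol{Z})^{-1}(\boldsymbol{y}-\bar{\boldsymbol{m}}(\boldsymbol{Z})),\qquad \sigma^2(\boldsymbol{z})=k(\boldsymbol{z},\boldsymbol{z})-\boldsymbol{k}(\boldsymbol{z},\boldsymbol{Z})\boldsymbol{K}(\boldsymbol{Z},\boldsymbol{Z})^{-1}\boldsymbol{k}(\boldsymbol{z},\boldsymbol{Z})^{\mathrm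 T},$$ where $\boldsymbol{k}(\boldsymbol{z},\boldsymbol{Z})=[k(\boldsymbol{z},\boldsymbol{z}_1)\ \cdots\ k(\boldsymbol{z},\boldsymbol{z}_N)]$, $\bar{\boldsymbol{m}}(\boldsymbol{Z})=(\bar m(\boldsymbol{z}_i))_{i=1,\dots,N}$, and $\boldsymbol{K}(\boldsymbol{Z},\boldsymbol{Z})$ has entries $k(\boldsymbol{z}_i,\boldsymbol{z}_j)$. In the theorem these formulas are applied to each component $v_{\mathrm{u},i}$ separately, giving $\bar v_{\mathrm{u},i}=\mu$ and $\sigma_{\mathrm{u},i}^2=\sigma^2$ for that component.
   Formalization: Where all posterior standard deviations vanish (e.g. at data points) both sides are 0, so "<" is replaced there by "≤"; the bound holds for each state z with probability at least 1−δ given the data, with one γ for all z; K(Z,Z) is assumed invertible. *)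

theory Defs
  imports "HOL-Probability.Probability"
begin

text \<open>States \<open>z = (x, v)\<close>: generalized position and generalized velocity.\<close>

type_synonym 'n state = "(real ^ 'n) \<times> (real ^ 'n)"

text \<open>The second argument is the standard deviation; the value \<open>0\<close> gives the degenerate normal
  distribution, a point mass, which posterior processes have at the data points.\<close>

definition normal_measure :: "real \<Rightarrow> real \<Rightarrow> real measure" where
  "normal_measure \<mu> \<sigma> =
     (if \<sigma> = 0 then return borel \<mu> else density lborel (\<lambda>x. ennreal (normal_density \<mu> \<sigma> x)))"

text \<open>Joint normality in the form that also covers singular covariance matrices:
  all linear combinations are normal.\<close>

definition jointly_normal :: "'w measure \<Rightarrow> ('i \<Rightarrow> 'w \<Rightarrow> real) \<Rightarrow> 'i set \<Rightarrow> bool" where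
  "jointly_normal M X I \<longleftrightarrow>
     (\<forall>i\<in>I. X i \<in> borel_measurable M) \<and>
     (\<forall>a. \<exists>\<mu> \<sigma>. 0 \<le> \<sigma> \<and>
        distr M borel (\<lambda>\<omega>. \<Sum>i\<in>I. a i * X i \<omega>) = normal_measure \<mu> \<sigma>)"

definition gaussian_process ::
    "'w measure \<Rightarrow> ('w \<Rightarrow> 'z \<Rightarrow> real) \<Rightarrow> ('z \<Rightarrow> real) \<Rightarrow> ('z \<Rightarrow> 'z \<Rightarrow> real) \<Rightarrow> bool" where
  "gaussian_process M f m k \<longleftrightarrow>
     (\<forall>S. finite S \<longrightarrow> jointly_normal M (\<lambda>z \<omega>. f \<omega> z) S) \<and>
     (\<forall>z. integral\<^sup>L M (\<lambda>\<omega>. f \<omega> z) = m z) \<and>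
     (\<forall>z z'. integral\<^sup>L M (\<lambda>\<omega>. (f \<omega> z - m z) * (f \<omega> z' - m z')) = k z z')"

text \<open>The components are independent as processes, i.e. as random elements of the
  product space \<open>\<real>\<^sup>Z\<close> of all functions on the index set.\<close>

definition vector_gaussian_process ::
    "'w measure \<Rightarrow> ('w \<Rightarrow> 'z \<Rightarrow> real ^ 'd) \<Rightarrow> ('d \<Rightarrow> 'z \<Rightarrow> real) \<Rightarrow>
     ('d \<Rightarrow> 'z \<Rightarrow> 'z \<Rightarrow> real) \<Rightarrow> bool" where
  "vector_gaussian_process M f m k \<longleftrightarrow>
     (\<forall>i. gaussian_process M (\<lambda>\<omega> z. f \<omega> z $ i) (m i) (k i)) \<and>
     prob_space.indep_vars M (\<lambda>i. Pi\<^sub>M UNIV (\<lambda>z. borel)) (\<lambda>i \<omega> z. f \<omega> z $ i) UNIV"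

definition gram_matrix :: "('z \<Rightarrow> 'z \<Rightarrow> real) \<Rightarrow> ('N::finite \<Rightarrow> 'z) \<Rightarrow> real ^ 'N ^ 'N" where
  "gram_matrix k Z = (\<chi> i j. k (Z i) (Z j))"

definition kernel_vector :: "('z \<Rightarrow> 'z \<Rightarrow> real) \<Rightarrow> 'z \<Rightarrow> ('N::finite \<Rightarrow> 'z) \<Rightarrow> real ^ 'N" where
  "kernel_vector k z Z = (\<chi> j. k z (Z j))"

definition posterior_mean ::
    "('z \<Rightarrow> real) \<Rightarrow> ('z \<Rightarrow> 'z \<Rightarrow> real) \<Rightarrow> ('N::finite \<Rightarrow> 'z) \<Rightarrow> real ^ 'N \<Rightarrow> 'z \<Rightarrow> real" where
  "posterior_mean m k Z y z =
     m z + kernel_vector k z Z \<bullet> (matrix_inv (gram_matrix k Z) *v (y - (\<chi> j. m (Z j))))"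

definition posterior_var ::
    "('z \<Rightarrow> 'z \<Rightarrow> real) \<Rightarrow> ('N::finite \<Rightarrow> 'z) \<Rightarrow> 'z \<Rightarrow> real" where
  "posterior_var k Z z =
     k z z - kernel_vector k z Z \<bullet> (matrix_inv (gram_matrix k Z) *v kernel_vector k z Z)"

definition posterior_sd ::
    "('z \<Rightarrow> 'z \<Rightarrow> real) \<Rightarrow> ('N::finite \<Rightarrow> 'z) \<Rightarrow> 'z \<Rightarrow> real" where
  "posterior_sd k Z z = sqrt (posterior_var k Z z)"

text \<open>The posterior mean of a vector-valued process, where \<open>u\<close> is the function that
  generates the data \<open>(Z j, u (Z j))\<close>.\<close>

definition posterior_mean_vec ::
    "('d \<Rightarrow> 'z \<Rightarrow> real) \<Rightarrow> ('d \<Rightarrow> 'z \<Rightarrow> 'z \<Rightarrow> real) \<Rightarrow> ('N::finite \<Rightarrow> 'z) \<Rightarrow>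
     ('z \<Rightarrow> real ^ 'd) \<Rightarrow> 'z \<Rightarrow> real ^ 'd" where
  "posterior_mean_vec m k Z u z = (\<chi> i. posterior_mean (m i) (k i) Z (\<chi> j. u (Z j) $ i) z)"

text \<open>The conditional probability of \<open>P\<close> given a random variable \<open>Y\<close>. It is itself a random
  variable, determined up to null sets; this is what conditioning on the data means when
  each single value of the data has probability zero.\<close>

definition cond_prob_given ::
    "'w measure \<Rightarrow> ('w \<Rightarrow> 'y::topological_space) \<Rightarrow> ('w \<Rightarrow> bool) \<Rightarrow> 'w \<Rightarrow> real" where
  "cond_prob_given M Y P =
     real_cond_exp M (vimage_algebra (space M) Y borel) (indicator {\<omega> \<in> space M. P \<omega>})"

definition projection_argmin ::
    "(real ^ 'd \<Rightarrow> real ^ 'c) \<Rightarrow> real ^ 'd \<Rightarrow> (real ^ 'd) set" where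
  "projection_argmin g u = {\<nu>. is_arg_min (\<lambda>\<nu>. (norm (\<nu> - u))\<^sup>2) (\<lambda>\<nu>. g \<nu> = 0) \<nu>}"

end

theory Submission
  imports Defs
begin

text \<open>
  Componentwise, the prediction error is a centred linear combination of values of the
  process, is uncorrelated with the data, and has variance \<open>\<sigma>\<^sup>2\<close>. Its joint characteristic function
  with the data therefore factorises, so by Kac's theorem the error is independent of the data, and
  conditioning on the data does not change probabilities of events about it. By Chebyshev's
  inequality and a union bound, with probability \<open>1 - \<delta>\<close> every component of the error is at most
  \<open>c \<sigma>\<^sub>i\<close> with \<open>c = sqrt (d / \<delta>)\<close>. The Lipschitz bound then gives the claim for \<open>\<gamma> = c (L + 1)\<close>;
  the summand \<open>1\<close> makes the inequality strict and \<open>\<gamma>\<close> positive when \<open>L = 0\<close>.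
\<close>

section \<open>Characteristic functions: uniqueness and Kac's criterion for independence\<close>

text \<open>The class of sets \<open>A\<close> on which all the integrals of \<open>cos (t \<bullet> x + \<theta>)\<close> agree is closed under
  intersection with slabs \<open>x \<bullet> b \<in> C\<close>: the weight \<open>2 + indicator A x * cos (t \<bullet> x + \<theta>)\<close> is positive,
  and by the product formula for cosines the images of the weighted measures under \<open>x \<bullet> b\<close> have the
  same characteristic function, so Levy's one-dimensional theorem applies.\<close>

lemma uniqueness_of_cos_integrals:
  fixes M N :: "'a::euclidean_space measure"
  assumes "prob_space M" "prob_space N" and sM[measurable_cong]: "sets M = sets borel"
    and sN[measurable_cong]: "sets N = sets borel"
    and eq: "\<And>t \<theta>. (\<integral>x. cos (t \<bullet> x + \<theta>) \<partial>M) = (\<integral>x. cos (t \<bullet> x + \<theta>) \<partial>N)"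
  shows "M = N"
proof -
  interpret M: prob_space M by fact
  interpret N: prob_space N by fact
  define good where "good A \<longleftrightarrow> A \<in> sets borel \<and>
    (\<forall>t \<theta>. (\<integral>x. indicator A x * cos (t \<bullet> x + \<theta>) \<partial>M) = (\<integral>x. indicator A x * cos (t \<bullet> x + \<theta>) \<partial>N))"
    for A :: "'a set"
  have good_UNIV: "good UNIV" using eq by (simp add: good_def)
  have int_cos: "integrable K (\<lambda>x. indicator A x * cos (t \<bullet> x + \<theta>))"
    if "prob_space K" and [measurable_cong]: "sets K = sets borel"
      and [measurable]: "A \<in> sets borel" for K and A :: "'a set" and t \<theta>
  proof -
    interpret K: prob_space K by fact
    show ?thesis by (rule K.integrable_const_bound[where B=1]) (auto simp: abs_mult indicator_def)
  qed
  have step: "good (A \<inter> {x. x \<bullet> b \<in> C})"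
    if A: "good A" and C[measurable]: "C \<in> sets borel" for A and C :: "real set" and b :: 'a
  proof -
    have [measurable]: "A \<in> sets borel" using A by (simp add: good_def)
    have "(\<integral>x. indicator (A \<inter> {x. x \<bullet> b \<in> C}) x * cos (t \<bullet> x + \<theta>) \<partial>M) =
          (\<integral>x. indicator (A \<inter> {x. x \<bullet> b \<in> C}) x * cos (t \<bullet> x + \<theta>) \<partial>N)" for t \<theta>
    proof -
      \<comment> \<open>The set is a parameter because the weight is needed twice:
        \<open>h {}\<close> is the constant \<open>2\<close>, and subtracting its integral from that
        of \<open>h A\<close> leaves exactly the cosine term over \<open>A\<close>.\<close>
      define h where "h B x = 2 + indicator B x * cos (t \<bullet> x + \<theta>)" for B :: "'a set" and x
      have hm[measurable]: "h B \<in> borel_measurable borel" if "B \<in> sets borel" for B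
        using that unfolding h_def[abs_def] by measurable
      have h1: "1 \<le> h B x" for B x
        using cos_ge_minus_one[of "t \<bullet> x + \<theta>"] by (simp add: h_def indicator_def; linarith)
      have h3: "h B x \<le> 3" for B x
        using cos_le_one[of "t \<bullet> x + \<theta>"] by (auto simp: h_def indicator_def)
      have ih: "(\<integral>x. indicator C (x \<bullet> b) * h B x \<partial>M) = (\<integral>x. indicator C (x \<bullet> b) * h B x \<partial>N)"
        if B: "good B" for B
      proof -
        have [measurable]: "B \<in> sets borel" using B by (simp add: good_def)
        define c where "c = (\<integral>x. h B x \<partial>M)"
        have int_h: "integrable K (h B)" if "prob_space K" and [measurable_cong]: "sets K = sets borel" for K
        proof -
          interpret K: prob_space K by fact
          show ?thesis
            by (rule K.integrable_const_bound[where B=3])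
              (use h3[of B] order_trans[OF zero_le_one h1[of B]] in \<open>auto simp: abs_of_nonneg\<close>)
        qed
        note hiM = int_h[OF M.prob_space_axioms sM] and hiN = int_h[OF N.prob_space_axioms sN]
        \<comment> \<open>The product of two cosines is half the sum of two cosines with frequencies
          \<open>u + t\<close> and \<open>u - t\<close>, so only integrals over \<open>UNIV\<close>
          and \<open>B\<close> appear, both already known to agree. Inserting
          \<open>indicator UNIV\<close> lets \<open>int_cos\<close> cover the first summand as
          well.\<close>
        have cos_h: "(\<integral>x. cos (u \<bullet> x + \<phi>) * h B x \<partial>K) =
            2 * (\<integral>x. cos (u \<bullet> x + \<phi>) \<partial>K)
            + (\<integral>x. indicator B x * cos ((t + u) \<bullet> x + (\<theta> + \<phi>)) \<partial>K) / 2
            + (\<integral>x. indicator B x * cos ((u - t) \<bullet> x + (\<phi> - \<theta>)) \<partial>K) / 2"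
          if K: "prob_space K" "sets K = sets borel" for K u \<phi>
        proof -
          have "(\<integral>x. cos (u \<bullet> x + \<phi>) * h B x \<partial>K) =
            (\<integral>x. 2 * (indicator UNIV x * cos (u \<bullet> x + \<phi>))
              + indicator B x * cos ((t + u) \<bullet> x + (\<theta> + \<phi>)) / 2
              + indicator B x * cos ((u - t) \<bullet> x + (\<phi> - \<theta>)) / 2 \<partial>K)"
            by (rule Bochner_Integration.integral_cong)
              (auto simp: h_def indicator_def cos_times_cos algebra_simps inner_simps)
          also have "\<dots> = 2 * (\<integral>x. indicator UNIV x * cos (u \<bullet> x + \<phi>) \<partial>K)
            + (\<integral>x. indicator B x * cos ((t + u) \<bullet> x + (\<theta> + \<phi>)) \<partial>K) / 2
            + (\<integral>x. indicator B x * cos ((u - t) \<bullet> x + (\<phi> - \<theta>)) \<partial>K) / 2"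
            using int_cos[OF K, of UNIV] int_cos[OF K, of B] by simp
          finally show ?thesis by simp
        qed
        have cos_eq: "(\<integral>x. cos (u \<bullet> x + \<phi>) * h B x \<partial>M) = (\<integral>x. cos (u \<bullet> x + \<phi>) * h B x \<partial>N)" for u \<phi>
          using B eq unfolding cos_h[OF M.prob_space_axioms sM] cos_h[OF N.prob_space_axioms sN] good_def
          by simp
        \<comment> \<open>Frequency and phase \<open>0\<close> give equal total weights, so one
          constant \<open>c\<close> normalises both weighted measures.\<close>
        have cN: "c = (\<integral>x. h B x \<partial>N)"
          using cos_eq[of 0 0] by (simp add: c_def)
        have "(\<integral>x. 1 \<partial>M) \<le> c"
          unfolding c_def by (rule integral_mono) (use hiM h1 in auto)
        then have c1: "1 \<le> c" by (simp add: M.prob_space)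
        define D where "D K = distr (density K (\<lambda>x. ennreal (h B x / c))) borel (\<lambda>x. x \<bullet> b)" for K :: "'a measure"
        have int_D: "integral\<^sup>L (D K) f = (\<integral>x. (h B x / c) *\<^sub>R f (x \<bullet> b) \<partial>K)"
          if [measurable_cong]: "sets K = sets borel" and [measurable]: "f \<in> borel_measurable borel"
          for K and f :: "real \<Rightarrow> 'b::{banach, second_countable_topology}"
          unfolding D_def
          apply (subst integral_distr, measurable)
          apply (subst integral_density)
          using h1 c1 by (auto intro!: divide_nonneg_nonneg order_trans[OF zero_le_one h1])
        have rd: "real_distribution (D K)"
          if K: "sets K = sets borel" "integrable K (h B)" "(\<integral>x. h B x \<partial>K) = c" for K
        proof -
          note [measurable_cong] = K(1)
          have "emeasure (density K (\<lambda>x. ennreal (h B x / c))) (space K) = (\<integral>\<^sup>+x. ennreal (h B x / c) \<partial>K)"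
            by (subst emeasure_density) (auto intro!: nn_integral_cong)
          also have "\<dots> = ennreal (\<integral>x. h B x / c \<partial>K)"
            using K c1 by (intro nn_integral_eq_integral) (auto intro!: divide_nonneg_nonneg order_trans[OF zero_le_one h1])
          also have "\<dots> = 1" using K c1 by simp
          finally have "prob_space (density K (\<lambda>x. ennreal (h B x / c)))"
            by (intro prob_spaceI) simp
          then have "prob_space (D K)"
            unfolding D_def by (rule prob_space.prob_space_distr) (measurable)
          then show ?thesis
            by (simp add: real_distribution_def real_distribution_axioms_def D_def)
        qed
        have "char (D M) s = char (D N) s" for s
        proof -
          \<comment> \<open>The phase \<open>- pi/2\<close> turns the cosine into a sine; thus the
            imaginary part is also covered by \<open>cos_eq\<close>.\<close>
          have "char (D K) s = complex_of_real ((\<integral>x. cos ((s *\<^sub>R b) \<bullet> x + 0) * h B x \<partial>K) / c)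
              + \<i> * complex_of_real ((\<integral>x. cos ((s *\<^sub>R b) \<bullet> x + (- pi/2)) * h B x \<partial>K) / c)"
            if K[measurable_cong]: "sets K = sets borel" "integrable K (h B)" for K
          proof -
            have i: "integrable K (\<lambda>x. cos ((s *\<^sub>R b) \<bullet> x + \<phi>) * h B x)" for \<phi>
              by (rule Bochner_Integration.integrable_bound[OF K(2)]) (auto simp: abs_mult mult_left_le_one_le)
            have "char (D K) s = (CLINT x|K. (h B x / c) *\<^sub>R iexp (s * (x \<bullet> b)))"
              unfolding char_def by (subst int_D) (auto simp: K(1))
            also have "\<dots> = (CLINT x|K. complex_of_real (cos ((s *\<^sub>R b) \<bullet> x + 0) * h B x / c)
               + \<i> * complex_of_real (cos ((s *\<^sub>R b) \<bullet> x + (- pi/2)) * h B x / c))"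
              by (rule Bochner_Integration.integral_cong)
                (auto simp: complex_eq_iff Re_exp Im_exp inner_commute cos_diff cos_add)
            also have "\<dots> = complex_of_real ((\<integral>x. cos ((s *\<^sub>R b) \<bullet> x + 0) * h B x \<partial>K) / c)
              + \<i> * complex_of_real ((\<integral>x. cos ((s *\<^sub>R b) \<bullet> x + (- pi/2)) * h B x \<partial>K) / c)"
              using i[of 0] i[of "- pi/2"]
              by (subst Bochner_Integration.integral_add) (auto simp del: of_real_divide of_real_mult)
            finally show ?thesis .
          qed
          then show ?thesis using sM sN hiM hiN by (simp only: cos_eq)
        qed
        then have "D M = D N"
          using rd[OF sM hiM] rd[OF sN hiN] cN c_def by (intro Levy_uniqueness) auto
        then have "(\<integral>y. indicator C y \<partial>(D M)) = (\<integral>y. (indicator C y :: real) \<partial>(D N))" by simp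
        then have "(\<integral>x. (indicator C (x \<bullet> b) * h B x) / c \<partial>M) = (\<integral>x. (indicator C (x \<bullet> b) * h B x) / c \<partial>N)"
          unfolding int_D[OF sM borel_measurable_indicator[OF C]] int_D[OF sN borel_measurable_indicator[OF C]]
          by (simp add: mult.commute)
        then show ?thesis using c1 by simp
      qed
      have g0: "good {}" by (simp add: good_def)
      have split: "(\<integral>x. indicator (A \<inter> {x. x \<bullet> b \<in> C}) x * cos (t \<bullet> x + \<theta>) \<partial>K) =
        (\<integral>x. indicator C (x \<bullet> b) * h A x \<partial>K) - (\<integral>x. indicator C (x \<bullet> b) * h {} x \<partial>K)"
        if "prob_space K" and [measurable_cong]: "sets K = sets borel" for K
      proof -
        interpret K: prob_space K by fact
        have "integrable K (\<lambda>x. indicator C (x \<bullet> b) * h B x)" if [measurable]: "B \<in> sets borel" for B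
          by (rule K.integrable_const_bound[where B=3])
            (use h1[of B] h3[of B] order_trans[OF zero_le_one h1] in \<open>auto simp: abs_of_nonneg indicator_def\<close>)
        then have "(\<integral>x. indicator C (x \<bullet> b) * h A x \<partial>K) - (\<integral>x. indicator C (x \<bullet> b) * h {} x \<partial>K)
          = (\<integral>x. indicator C (x \<bullet> b) * h A x - indicator C (x \<bullet> b) * h {} x \<partial>K)"
          by simp
        also have "\<dots> = (\<integral>x. indicator (A \<inter> {x. x \<bullet> b \<in> C}) x * cos (t \<bullet> x + \<theta>) \<partial>K)"
          by (rule Bochner_Integration.integral_cong) (auto simp: h_def indicator_def)
        finally show ?thesis by simp
      qed
      show ?thesis
        unfolding split[OF M.prob_space_axioms sM] split[OF N.prob_space_axioms sN] ih[OF A] ih[OF g0] ..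
    qed
    moreover have "A \<inter> {x. x \<bullet> b \<in> C} \<in> sets borel" by measurable
    ultimately show ?thesis by (simp add: good_def)
  qed
  \<comment> \<open>A box is a finite intersection of slabs, one for each basis vector;
    \<open>step\<close> adds one slab at a time.\<close>
  have "good {x. \<forall>b\<in>J. l \<bullet> b < x \<bullet> b \<and> x \<bullet> b < u \<bullet> b}" if "finite J" for J :: "'a set" and l u :: 'a
    using that
  proof induction
    case empty
    then show ?case using good_UNIV by simp
  next
    case (insert b J)
    have "{x. \<forall>b\<in>insert b J. l \<bullet> b < x \<bullet> b \<and> x \<bullet> b < u \<bullet> b} =
      {x. \<forall>b\<in>J. l \<bullet> b < x \<bullet> b \<and> x \<bullet> b < u \<bullet> b} \<inter> {x. x \<bullet> b \<in> {l \<bullet> b <..< u \<bullet> b}}" by auto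
    then show ?case using step[OF insert.IH, of "{l \<bullet> b <..< u \<bullet> b}" b] by simp
  qed
  from this[OF finite_Basis] have gb: "good (box l u)" for l u by (simp add: box_def)
  have box_eq: "emeasure M (box l u) = emeasure N (box l u)" for l u
  proof -
    \<comment> \<open>For \<open>t = 0\<close> and phase \<open>0\<close> the cosine is
      \<open>1\<close>, and the integrals over a good set are its measures.\<close>
    have "measure M (box l u) = measure N (box l u)"
      using gb[of l u] unfolding good_def by (auto dest: spec[of _ 0] spec2[of _ 0 0] simp: sM sN sets_eq_imp_space_eq[OF sM] sets_eq_imp_space_eq[OF sN])
    then show ?thesis by (simp add: M.emeasure_eq_measure N.emeasure_eq_measure)
  qed
  let ?E = "range (\<lambda>(a, b). box a b::'a set)"
  show "M = N"
  proof (rule measure_eqI_generator_eq)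
    show "Int_stable ?E" "?E \<subseteq> Pow UNIV"
      by (auto simp: Int_stable_def box_Int_box)
    show "sets M = sigma_sets UNIV ?E" "sets N = sigma_sets UNIV ?E"
      by (simp_all add: sM sN borel_eq_box)
    let ?A = "\<lambda>n::nat. box (- (real n *\<^sub>R One)) (real n *\<^sub>R One) :: 'a set"
    show "range ?A \<subseteq> ?E" "(\<Union>i. ?A i) = UNIV"
      by (auto simp: UN_box_eq_UNIV)
    show "emeasure M (?A i) \<noteq> \<infinity>" for i by simp
    show "emeasure M X = emeasure N X" if "X \<in> ?E" for X
      using that box_eq by auto
  qed
qed

text \<open>Kac's theorem. The factorisation says that the joint law of \<open>X\<close> and
  \<open>Y\<close> and the product of their laws have the same characteristic function, hence
  coincide; evaluating both on \<open>A \<times> B\<close> gives the claim.\<close>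

lemma (in prob_space) indep_if_char_product:
  fixes X :: "'a \<Rightarrow> 'b::euclidean_space" and Y :: "'a \<Rightarrow> 'c::euclidean_space"
  assumes [measurable]: "X \<in> borel_measurable M" "Y \<in> borel_measurable M"
    and prod: "\<And>s t. (CLINT \<omega>|M. iexp (s \<bullet> X \<omega> + t \<bullet> Y \<omega>)) =
      (CLINT \<omega>|M. iexp (s \<bullet> X \<omega>)) * (CLINT \<omega>|M. iexp (t \<bullet> Y \<omega>))"
    and [measurable]: "A \<in> sets borel" "B \<in> sets borel"
  shows "prob {\<omega> \<in> space M. X \<omega> \<in> A \<and> Y \<omega> \<in> B} =
    prob {\<omega> \<in> space M. X \<omega> \<in> A} * prob {\<omega> \<in> space M. Y \<omega> \<in> B}"
proof -
  interpret X: prob_space "distr M borel X" by (rule prob_space_distr) simp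
  interpret Y: prob_space "distr M borel Y" by (rule prob_space_distr) simp
  interpret XY: pair_prob_space "distr M borel X" "distr M borel Y" ..
  have "distr M borel X \<Otimes>\<^sub>M distr M borel Y = distr M (borel \<Otimes>\<^sub>M borel) (\<lambda>\<omega>. (X \<omega>, Y \<omega>))" (is "?P = ?J")
  proof (rule uniqueness_of_cos_integrals)
    interpret J: prob_space ?J by (rule prob_space_distr) measurable
    show "prob_space ?P" by (rule XY.prob_space_axioms)
    show "prob_space ?J" by (rule J.prob_space_axioms)
    have s: "sets (distr M borel X \<Otimes>\<^sub>M distr M borel Y) = sets (borel \<Otimes>\<^sub>M borel)"
      by (rule sets_pair_measure_cong) simp_all
    have "sets (borel \<Otimes>\<^sub>M borel) = sets (borel :: ('b \<times> 'c) measure)"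
      using borel_prod by (rule arg_cong)
    then show "sets ?P = sets borel" "sets ?J = sets borel" using s by simp_all
    \<comment> \<open>This passes from characteristic functions to the phased cosine integrals
      required by \<open>uniqueness_of_cos_integrals\<close>.\<close>
    have cosRe: "(\<integral>x. cos (u x + \<theta>) \<partial>K) = Re (iexp \<theta> * (CLINT x|K. iexp (u x)))"
      if "prob_space K" and [measurable]: "u \<in> borel_measurable K" for K :: "('b \<times> 'c) measure" and u \<theta>
    proof -
      interpret K: prob_space K by fact
      have i: "integrable K (\<lambda>x. iexp \<theta> * iexp (u x))"
        by (intro integrable_mult_right K.integrable_iexp) auto
      have "(\<integral>x. cos (u x + \<theta>) \<partial>K) = (\<integral>x. Re (iexp \<theta> * iexp (u x)) \<partial>K)"
        by (rule Bochner_Integration.integral_cong) (simp_all add: Re_exp Im_exp cos_add)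
      also have "\<dots> = Re (CLINT x|K. iexp \<theta> * iexp (u x))" using i by (rule integral_Re)
      finally show ?thesis by simp
    qed
    fix t :: "'b \<times> 'c" and \<theta>
    obtain a b where t: "t = (a, b)" by (cases t)
    have mt[measurable]: "(\<lambda>x. t \<bullet> x) \<in> borel_measurable (borel \<Otimes>\<^sub>M borel)"
      unfolding borel_prod by measurable
    have mP: "(\<lambda>x. t \<bullet> x) \<in> borel_measurable ?P" using mt measurable_cong_sets[OF s refl] by blast
    have "(CLINT x|?P. iexp (t \<bullet> x)) = (CLINT x|?P. iexp (a \<bullet> fst x) * iexp (b \<bullet> snd x))"
      by (rule Bochner_Integration.integral_cong) (auto simp: t inner_prod_def exp_add algebra_simps)
    also have "\<dots> = (CLINT x|distr M borel X. CLINT y|distr M borel Y. iexp (a \<bullet> x) * iexp (b \<bullet> y))"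
    proof -
      have "integrable ?P (\<lambda>x. iexp (t \<bullet> x))"
        by (rule XY.integrable_iexp) (use mP in auto)
      then have "integrable ?P (\<lambda>x. iexp (a \<bullet> fst x) * iexp (b \<bullet> snd x))"
        by (rule Bochner_Integration.integrable_cong[THEN iffD1, rotated 2]) (auto simp: t inner_prod_def exp_add algebra_simps)
      then show ?thesis by (subst XY.integral_fst'[symmetric]) simp_all
    qed
    also have "\<dots> = (CLINT x|distr M borel X. iexp (a \<bullet> x)) * (CLINT y|distr M borel Y. iexp (b \<bullet> y))"
      by simp
    also have "\<dots> = (CLINT \<omega>|M. iexp (a \<bullet> X \<omega> + b \<bullet> Y \<omega>))"
      unfolding prod by (simp add: integral_distr)
    also have "\<dots> = (CLINT x|?J. iexp (t \<bullet> x))"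
      by (subst integral_distr) (auto simp: t inner_prod_def)
    finally show "(\<integral>x. cos (t \<bullet> x + \<theta>) \<partial>?P) = (\<integral>x. cos (t \<bullet> x + \<theta>) \<partial>?J)"
      using cosRe[OF XY.prob_space_axioms mP] cosRe[OF J.prob_space_axioms, of "\<lambda>x. t \<bullet> x"] by simp
  qed
  then have "emeasure ?P (A \<times> B) = emeasure ?J (A \<times> B)" by simp
  then have "ennreal (prob (X -` A \<inter> space M) * prob (Y -` B \<inter> space M)) =
      ennreal (prob ((\<lambda>\<omega>. (X \<omega>, Y \<omega>)) -` (A \<times> B) \<inter> space M))"
    by (simp add: Y.emeasure_pair_measure_Times emeasure_distr emeasure_eq_measure ennreal_mult)
  moreover have "X -` A \<inter> space M = {\<omega> \<in> space M. X \<omega> \<in> A}" "Y -` B \<inter> space M = {\<omega> \<in> space M. Y \<omega> \<in> B}"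
    "(\<lambda>\<omega>. (X \<omega>, Y \<omega>)) -` (A \<times> B) \<inter> space M = {\<omega> \<in> space M. X \<omega> \<in> A \<and> Y \<omega> \<in> B}"
    by auto
  ultimately show ?thesis by (simp add: ennreal_inj)
qed

section \<open>Normal distributions, including the degenerate ones\<close>

text \<open>Representing point masses and proper normal laws alike as affine images of the standard
  normal law lets moments and characteristic functions be computed without a case distinction on
  \<open>\<sigma>\<close>.\<close>

lemma normal_measure_eq_distr:
  assumes "0 \<le> \<sigma>"
  shows "normal_measure \<mu> \<sigma> = distr std_normal_distribution borel (\<lambda>x. \<mu> + \<sigma> * x)"
proof -
  interpret S: prob_space std_normal_distribution by (rule prob_space_normal_density) simp
  show ?thesis
  proof (cases "\<sigma> = 0")
    case True
    then show ?thesis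
      by (simp add: normal_measure_def S.distr_const)
  next
    case False
    have "distributed std_normal_distribution lborel (\<lambda>x. x) std_normal_density"
      by (simp add: distributed_def distr_id2)
    from S.normal_density_affine[OF this, of \<sigma> \<mu>] False assms
    have "distr std_normal_distribution lborel (\<lambda>x. \<mu> + \<sigma> * x) = density lborel (normal_density \<mu> \<sigma>)"
      by (simp add: distributed_def)
    moreover have "distr std_normal_distribution lborel (\<lambda>x. \<mu> + \<sigma> * x) = distr std_normal_distribution borel (\<lambda>x. \<mu> + \<sigma> * x)"
      by (rule distr_cong) simp_all
    ultimately show ?thesis using False by (simp add: normal_measure_def)
  qed
qed

text \<open>Every claim is transferred to \<open>\<mu> + \<sigma> * x\<close> under the standard
  normal law. The last one is the standard normal characteristic function at
  \<open>\<sigma>\<close>.\<close>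

lemma (in prob_space) normal_variable_moments:
  assumes W[measurable]: "W \<in> borel_measurable M"
    and d: "distr M borel W = normal_measure \<mu> \<sigma>" and "0 \<le> \<sigma>"
  shows "integrable M W" "integrable M (\<lambda>\<omega>. (W \<omega>)\<^sup>2)" "expectation W = \<mu>"
    "expectation (\<lambda>\<omega>. (W \<omega> - \<mu>)\<^sup>2) = \<sigma>\<^sup>2"
    "(CLINT \<omega>|M. iexp (W \<omega> - \<mu>)) = exp (- complex_of_real (\<sigma>\<^sup>2) / 2)"
proof -
  let ?S = "std_normal_distribution"
  interpret S: prob_space ?S by (rule prob_space_normal_density) simp
  have e: "distr M borel W = distr ?S borel (\<lambda>x. \<mu> + \<sigma> * x)"
    using d normal_measure_eq_distr[OF \<open>0 \<le> \<sigma>\<close>] by simp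
  have int: "integrable M (\<lambda>\<omega>. h (W \<omega>)) \<longleftrightarrow> integrable ?S (\<lambda>x. h (\<mu> + \<sigma> * x))"
    if [measurable]: "h \<in> borel_measurable borel" for h :: "real \<Rightarrow> real"
    using arg_cong[OF e, of "\<lambda>K. integrable K h"] by (simp add: integrable_distr_eq)
  have val: "(\<integral>\<omega>. h (W \<omega>) \<partial>M) = (\<integral>x. h (\<mu> + \<sigma> * x) \<partial>?S)"
    if [measurable]: "h \<in> borel_measurable borel" for h :: "real \<Rightarrow> 'b::{banach, second_countable_topology}"
    using arg_cong[OF e, of "\<lambda>K. integral\<^sup>L K h"] by (simp add: integral_distr)
  have i1: "integrable ?S (\<lambda>x. x)" and i2: "integrable ?S (\<lambda>x. x\<^sup>2)"
    using integrable_std_normal_moment[of 1] integrable_std_normal_moment[of 2]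
    by (simp_all add: integrable_density)
  \<comment> \<open>The indices \<open>0\<close> and \<open>1\<close> select the moments of order
    \<open>2 * 0 + 1\<close> and \<open>2 * 1\<close>.\<close>
  have v1: "(\<integral>x. x \<partial>?S) = 0" and v2: "(\<integral>x. x\<^sup>2 \<partial>?S) = 1"
    using integral_std_normal_moment_odd[of 0] integral_std_normal_moment_even[of 1]
    by (simp_all add: integral_density)
  have j1: "integrable ?S (\<lambda>x. \<mu> + \<sigma> * x)"
    by (intro Bochner_Integration.integrable_add integrable_mult_right i1 S.integrable_const)
  have "integrable M W = integrable ?S (\<lambda>x. \<mu> + \<sigma> * x)"
    by (rule int) measurable
  then show "integrable M W" using j1 by (rule iffD2)
  have "integrable ?S (\<lambda>x. \<mu>\<^sup>2 + \<sigma>\<^sup>2 * x\<^sup>2 + (2 * \<mu> * \<sigma>) * x)"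
    by (intro Bochner_Integration.integrable_add integrable_mult_right i1 i2 S.integrable_const)
  then have j2: "integrable ?S (\<lambda>x. (\<mu> + \<sigma> * x)\<^sup>2)"
    by (simp only: power2_sum power_mult_distrib mult.assoc)
  have "integrable M (\<lambda>\<omega>. (W \<omega>)\<^sup>2) = integrable ?S (\<lambda>x. (\<mu> + \<sigma> * x)\<^sup>2)"
    by (rule int) measurable
  then show "integrable M (\<lambda>\<omega>. (W \<omega>)\<^sup>2)" using j2 by (rule iffD2)
  have "expectation W = (\<integral>x. \<mu> + \<sigma> * x \<partial>?S)"
    by (rule val) measurable
  also have "\<dots> = (\<integral>x. \<mu> \<partial>?S) + (\<integral>x. \<sigma> * x \<partial>?S)"
    by (intro Bochner_Integration.integral_add integrable_mult_right i1 S.integrable_const)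
  also have "(\<integral>x. \<mu> \<partial>?S) = \<mu>" 
    by (subst lebesgue_integral_const) (simp only: S.prob_space scaleR_one)
  also have "(\<integral>x. \<sigma> * x \<partial>?S) = 0"
    unfolding integral_mult_right_zero v1 by simp
  finally show "expectation W = \<mu>" by simp
  have "expectation (\<lambda>\<omega>. (W \<omega> - \<mu>)\<^sup>2) = (\<integral>x. (\<mu> + \<sigma> * x - \<mu>)\<^sup>2 \<partial>?S)"
    by (rule val) measurable
  also have "\<dots> = (\<integral>x. \<sigma>\<^sup>2 * x\<^sup>2 \<partial>?S)"
    by (rule Bochner_Integration.integral_cong) (simp_all add: power_mult_distrib)
  also have "\<dots> = \<sigma>\<^sup>2"
    unfolding integral_mult_right_zero v2 by simp
  finally show "expectation (\<lambda>\<omega>. (W \<omega> - \<mu>)\<^sup>2) = \<sigma>\<^sup>2" .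
  have "(CLINT \<omega>|M. iexp (W \<omega> - \<mu>)) = (CLINT x|?S. iexp (\<mu> + \<sigma> * x - \<mu>))"
    by (rule val) measurable
  also have "\<dots> = char ?S \<sigma>"
    unfolding char_def by (rule Bochner_Integration.integral_cong) simp_all
  finally have "(CLINT \<omega>|M. iexp (W \<omega> - \<mu>)) = char ?S \<sigma>" .
  then show "(CLINT \<omega>|M. iexp (W \<omega> - \<mu>)) = exp (- complex_of_real (\<sigma>\<^sup>2) / 2)"
    by (simp add: char_std_normal_distribution exp_of_real[symmetric])
qed

section \<open>Linear combinations of the values of a Gaussian process\<close>

text \<open>\<open>jointly_normal\<close> speaks of sums over sets of states, whereas here the
  points \<open>p j\<close> may coincide, as when a prediction is made at a data point. Coefficients
  belonging to the same point are added up.\<close>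

lemma gaussian_process_sum_normal:
  assumes gp: "gaussian_process M f m k" and J: "finite J"
  shows "\<exists>\<mu> \<sigma>. 0 \<le> \<sigma> \<and> distr M borel (\<lambda>\<omega>. \<Sum>j\<in>J. c j * f \<omega> (p j)) = normal_measure \<mu> \<sigma>"
proof -
  define a where "a z = (\<Sum>j\<in>{j\<in>J. p j = z}. c j)" for z
  have "jointly_normal M (\<lambda>z \<omega>. f \<omega> z) (p ` J)"
    using gp J by (simp add: gaussian_process_def)
  then have "\<exists>\<mu> \<sigma>. 0 \<le> \<sigma> \<and> distr M borel (\<lambda>\<omega>. \<Sum>z\<in>p ` J. a z * f \<omega> z) = normal_measure \<mu> \<sigma>"
    by (simp add: jointly_normal_def)
  moreover have "(\<Sum>z\<in>p ` J. a z * f \<omega> z) = (\<Sum>j\<in>J. c j * f \<omega> (p j))" for \<omega>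
    unfolding sum.image_gen[OF J, of _ p] a_def sum_distrib_right
    by (intro sum.cong) auto
  ultimately show ?thesis by simp
qed

lemma gaussian_process_measurable:
  "gaussian_process M f m k \<Longrightarrow> (\<lambda>\<omega>. f \<omega> z) \<in> borel_measurable M"
  unfolding gaussian_process_def jointly_normal_def by (metis finite.emptyI finite.insertI insertI1)

text \<open>The integrals in \<open>gaussian_process\<close> do not yield integrability, since a
  Bochner integral is \<open>0\<close> by default when it does not exist. Normality of the single
  values does.\<close>

lemma (in prob_space) gaussian_process_square_integrable:
  assumes gp: "gaussian_process M f m k"
  shows "integrable M (\<lambda>\<omega>. f \<omega> z)" "integrable M (\<lambda>\<omega>. (f \<omega> z)\<^sup>2)"
proof -
  obtain \<mu> \<sigma> where "0 \<le> \<sigma>" "distr M borel (\<lambda>\<omega>. f \<omega> z) = normal_measure \<mu> \<sigma>"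
    using gaussian_process_sum_normal[OF gp, of "{()}" "\<lambda>_. 1" "\<lambda>_. z"] by auto
  with normal_variable_moments[OF gaussian_process_measurable[OF gp, of z]]
  show "integrable M (\<lambda>\<omega>. f \<omega> z)" "integrable M (\<lambda>\<omega>. (f \<omega> z)\<^sup>2)" by blast+
qed

text \<open>\<open>W\<close> is a normal variable minus its mean, so its characteristic function
  depends only on its variance, and expanding the square expresses the variance by
  covariances.\<close>

lemma (in prob_space) gaussian_process_sum:
  fixes c :: "'j \<Rightarrow> real" and p :: "'j \<Rightarrow> 'z"
  assumes gp: "gaussian_process M f m k" and J: "finite J"
  defines "W \<equiv> \<lambda>\<omega>. \<Sum>j\<in>J. c j * (f \<omega> (p j) - m (p j))"
    and "q \<equiv> \<Sum>j\<in>J. \<Sum>l\<in>J. c j * c l * k (p j) (p l)"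
  shows "integrable M (\<lambda>\<omega>. (W \<omega>)\<^sup>2)" "expectation W = 0" "expectation (\<lambda>\<omega>. (W \<omega>)\<^sup>2) = q"
    "(CLINT \<omega>|M. iexp (W \<omega>)) = exp (- complex_of_real q / 2)"
proof -
  note [measurable] = gaussian_process_measurable[OF gp]
  note int = gaussian_process_square_integrable[OF gp]
  define V where "V \<omega> = (\<Sum>j\<in>J. c j * f \<omega> (p j))" for \<omega>
  have Vm[measurable]: "V \<in> borel_measurable M" unfolding V_def[abs_def] by measurable
  obtain \<mu> \<sigma> where \<sigma>: "0 \<le> \<sigma>" "distr M borel V = normal_measure \<mu> \<sigma>"
    using gaussian_process_sum_normal[OF gp J] unfolding V_def[abs_def] by blast
  note V = normal_variable_moments[OF Vm \<sigma>(2,1)]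
  have mean: "expectation (\<lambda>\<omega>. f \<omega> z) = m z" for z
    using gp by (simp add: gaussian_process_def)
  \<comment> \<open>Normality provides some parameter \<open>\<mu>\<close>; computing the mean of
    \<open>V\<close> by linearity identifies it.\<close>
  have "\<mu> = (\<Sum>j\<in>J. c j * m (p j))"
    unfolding V(3)[symmetric] unfolding V_def using int by (simp add: mean)
  then have WV: "W = (\<lambda>\<omega>. V \<omega> - \<mu>)"
    by (auto simp: W_def V_def sum_subtractf algebra_simps)
  show "integrable M (\<lambda>\<omega>. (W \<omega>)\<^sup>2)"
    unfolding WV power2_diff using V(1,2) by simp
  show "expectation W = 0" unfolding WV using V by (simp add: prob_space)
  have cov: "expectation (\<lambda>\<omega>. (f \<omega> z - m z) * (f \<omega> z' - m z')) = k z z'" for z z'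
    using gp by (simp add: gaussian_process_def)
  have sq: "integrable M (\<lambda>\<omega>. (f \<omega> z - m z)\<^sup>2)" for z
    unfolding power2_diff using int by simp
  \<comment> \<open>Products of centred values are dominated by sums of squares; this justifies
    exchanging expectation and double sum below.\<close>
  have icov: "integrable M (\<lambda>\<omega>. (f \<omega> z - m z) * (f \<omega> z' - m z'))" for z z'
  proof (rule Bochner_Integration.integrable_bound[OF Bochner_Integration.integrable_add[OF sq[of z] sq[of z']]])
    have "\<bar>a * b\<bar> \<le> a\<^sup>2 + b\<^sup>2" for a b :: real
      using sum_squares_bound[of "\<bar>a\<bar>" "\<bar>b\<bar>"] mult_nonneg_nonneg[OF abs_ge_zero abs_ge_zero, of a b]
      unfolding abs_mult power2_abs by linarith
    then show "AE \<omega> in M. norm ((f \<omega> z - m z) * (f \<omega> z' - m z')) \<le> norm ((f \<omega> z - m z)\<^sup>2 + (f \<omega> z' - m z')\<^sup>2)"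
      by simp
  qed measurable
  have "(W \<omega>)\<^sup>2 = (\<Sum>j\<in>J. \<Sum>l\<in>J. c j * c l * ((f \<omega> (p j) - m (p j)) * (f \<omega> (p l) - m (p l))))" for \<omega>
    unfolding W_def power2_eq_square sum_product by (simp add: ac_simps)
  then show *: "expectation (\<lambda>\<omega>. (W \<omega>)\<^sup>2) = q"
    using icov by (simp add: cov q_def)
  then show "(CLINT \<omega>|M. iexp (W \<omega>)) = exp (- complex_of_real q / 2)"
    using V(4,5) unfolding WV by simp
qed

section \<open>The prediction error of a scalar process\<close>

lemma sum_UNIV_option: "(\<Sum>x\<in>UNIV. h x) = h None + (\<Sum>j\<in>UNIV. h (Some (j::'a::finite)))"
  by (simp add: UNIV_option_conv sum.reindex)

text \<open>With \<open>w = K\<inverse> k\<close>, the exponent is the quadratic form of the covariances at \<open>z\<close> and the \<open>Z j\<close> with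
  coefficients \<open>s\<close> and \<open>t - s w\<close>. It has no cross terms because \<open>K w = k\<close>: the prediction error \<open>R\<close>
  is uncorrelated with the data.\<close>

lemma (in prob_space) prediction_error:
  fixes Z :: "'N::finite \<Rightarrow> 'z" and z :: 'z
  assumes gp: "gaussian_process M f m k" and inv: "invertible (gram_matrix k Z)"
  defines "R \<equiv> \<lambda>\<omega>. f \<omega> z - posterior_mean m k Z (\<chi> j. f \<omega> (Z j)) z"
    and "y \<equiv> \<lambda>\<omega>. \<chi> j. f \<omega> (Z j) - m (Z j)"
  shows "integrable M (\<lambda>\<omega>. (R \<omega>)\<^sup>2)" "expectation R = 0" "expectation (\<lambda>\<omega>. (R \<omega>)\<^sup>2) = posterior_var k Z z"
    "(CLINT \<omega>|M. iexp (s * R \<omega> + t \<bullet> y \<omega>)) =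
       exp (- complex_of_real (s\<^sup>2 * posterior_var k Z z + t \<bullet> (gram_matrix k Z *v t)) / 2)"
proof -
  define K where "K = gram_matrix k Z"
  define kv where "kv = kernel_vector k z Z"
  define w where "w = kv v* matrix_inv K"
  \<comment> \<open>Symmetry of \<open>k\<close> comes from its being a covariance.\<close>
  have sym: "k x x' = k x' x" for x x'
  proof -
    have "expectation (\<lambda>\<omega>. (f \<omega> a - m a) * (f \<omega> b - m b)) = k a b" for a b
      using gp by (simp add: gaussian_process_def)
    from this[of x x'] this[of x' x] show ?thesis by (simp add: mult.commute)
  qed
  have Ksym: "transpose K = K"
    by (simp add: K_def gram_matrix_def transpose_def vec_eq_iff sym)
  \<comment> \<open>\<open>matrix_inv\<close> is defined by choice; invertibility guarantees that
    the chosen matrix is an inverse.\<close>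
  have KK: "matrix_inv K ** K = mat 1"
    using someI_ex[OF inv[unfolded invertible_def]] by (simp add: matrix_inv_def K_def)
  \<comment> \<open>\<open>w\<close> is defined as a row vector times the inverse; symmetry of
    \<open>K\<close> turns this into the linear system \<open>K *v w = kv\<close>.\<close>
  have "K *v w = w v* K"
    using transpose_matrix_vector[of K w] by (simp only: Ksym)
  also have "\<dots> = kv"
    by (simp only: w_def vector_matrix_mul_assoc KK vector_matrix_mul_rid)
  finally have Kw: "K *v w = kv" .
  have pv: "posterior_var k Z z = k z z - w \<bullet> kv"
    by (simp add: posterior_var_def w_def dot_lmul_matrix K_def kv_def)
  have R: "R \<omega> = (f \<omega> z - m z) - w \<bullet> y \<omega>" for \<omega>
    by (simp add: R_def posterior_mean_def w_def dot_lmul_matrix K_def kv_def y_def vec_eq_iff minus_vec_def)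
  \<comment> \<open>The option type indexes all points at once: \<open>None\<close> is the
    prediction point, \<open>Some j\<close> the data point \<open>Z j\<close>.\<close>
  define p where "p = case_option z Z"
  define c where "c s t = case_option s (\<lambda>j. (t - s *\<^sub>R w) $ j)" for s and t :: "real^'N"
  have lin: "s * R \<omega> + t \<bullet> y \<omega> = (\<Sum>j\<in>UNIV. c s t j * (f \<omega> (p j) - m (p j)))" for s t \<omega>
  proof -
    have "s * R \<omega> + t \<bullet> y \<omega> = s * (f \<omega> z - m z) + (t - s *\<^sub>R w) \<bullet> y \<omega>"
      by (simp add: R inner_diff_left algebra_simps)
    then show ?thesis
      by (simp add: sum_UNIV_option c_def p_def y_def inner_vec_def)
  qed
  have quad: "(\<Sum>j\<in>UNIV. \<Sum>l\<in>UNIV. c s t j * c s t l * k (p j) (p l)) = s\<^sup>2 * posterior_var k Z z + t \<bullet> (K *v t)" for s t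
  proof -
    let ?r = "t - s *\<^sub>R w"
    have 1: "(\<Sum>l\<in>UNIV. s * ?r $ l * k z (Z l)) = s * (?r \<bullet> kv)"
      by (simp add: inner_vec_def kv_def kernel_vector_def sum_distrib_left mult.assoc)
    have 2: "(\<Sum>j\<in>UNIV. ?r $ j * s * k (Z j) z) = s * (?r \<bullet> kv)"
      using 1 by (simp add: sym[of _ z] mult.commute mult.left_commute)
    have 3: "(\<Sum>j\<in>UNIV. \<Sum>l\<in>UNIV. ?r $ j * ?r $ l * k (Z j) (Z l)) = ?r \<bullet> (K *v ?r)"
      by (simp add: inner_vec_def K_def gram_matrix_def matrix_vector_mult_def sum_distrib_left ac_simps)
    have "(\<Sum>j\<in>UNIV. \<Sum>l\<in>UNIV. c s t j * c s t l * k (p j) (p l)) = s * s * k z z + 2 * (s * (?r \<bullet> kv)) + ?r \<bullet> (K *v ?r)"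
      unfolding 3[symmetric] using 1 2
      by (simp add: sum_UNIV_option c_def p_def sum.distrib)
    also have "?r \<bullet> (K *v ?r) = ?r \<bullet> (K *v t) - s * (?r \<bullet> kv)"
      by (simp add: matrix_vector_mult_diff_distrib matrix_vector_mult_scaleR Kw inner_diff_right)
    also have "?r \<bullet> (K *v t) = t \<bullet> (K *v t) - s * (kv \<bullet> t)"
    proof -
      have "w \<bullet> (K *v t) = kv \<bullet> t"
        using dot_lmul_matrix[of w K t] transpose_matrix_vector[of K w] by (simp only: Ksym Kw)
      then show ?thesis by (simp add: inner_diff_left)
    qed
    \<comment> \<open>Since \<open>?r \<bullet> kv = t \<bullet> kv - s * (w \<bullet> kv)\<close>,
      the terms linear in \<open>s\<close> cancel.\<close>
    finally show ?thesis
      by (simp add: pv inner_diff_left power2_eq_square algebra_simps inner_commute)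
  qed
  note sum = gaussian_process_sum[OF gp finite[of UNIV], where c="c s t" and p=p for s t, folded lin, unfolded quad]
  \<comment> \<open>The coefficients \<open>s = 1\<close> and \<open>t = 0\<close> single out
    \<open>R\<close> itself.\<close>
  show "integrable M (\<lambda>\<omega>. (R \<omega>)\<^sup>2)" "expectation R = 0" "expectation (\<lambda>\<omega>. (R \<omega>)\<^sup>2) = posterior_var k Z z"
    using sum(1-3)[of 1 0] by simp_all
  show "(CLINT \<omega>|M. iexp (s * R \<omega> + t \<bullet> y \<omega>)) =
       exp (- complex_of_real (s\<^sup>2 * posterior_var k Z z + t \<bullet> (gram_matrix k Z *v t)) / 2)"
    using sum(4)[of s t] by (simp add: K_def)
qed

section \<open>Tail bounds and conditional probability\<close>

text \<open>Chebyshev's inequality needs a positive threshold. With variance \<open>0\<close>, as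
  for a prediction at a data point, \<open>W\<close> vanishes almost surely and the event is
  null.\<close>

lemma (in prob_space) prob_abs_gt_multiple_sd_le:
  assumes [measurable]: "W \<in> borel_measurable M" and "integrable M (\<lambda>\<omega>. (W \<omega>)\<^sup>2)"
    and "expectation W = 0" and "0 < c"
  shows "prob {\<omega> \<in> space M. c * sqrt (expectation (\<lambda>\<omega>. (W \<omega>)\<^sup>2)) < \<bar>W \<omega>\<bar>} \<le> 1 / c\<^sup>2"
proof -
  let ?V = "expectation (\<lambda>\<omega>. (W \<omega>)\<^sup>2)"
  have "0 \<le> ?V" by simp
  show ?thesis
  proof (cases "?V = 0")
    case True
    then have "AE \<omega> in M. (W \<omega>)\<^sup>2 = 0"
      using assms(2) by (subst (asm) integral_nonneg_eq_0_iff_AE) auto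
    then have "prob {\<omega> \<in> space M. c * sqrt ?V < \<bar>W \<omega>\<bar>} = 0"
      using True by (subst prob_eq_0) auto
    then show ?thesis by simp
  next
    case False
    with \<open>0 \<le> ?V\<close> have V: "0 < ?V" by linarith
    have "prob {\<omega> \<in> space M. c * sqrt ?V < \<bar>W \<omega>\<bar>} \<le> prob {\<omega> \<in> space M. c * sqrt ?V \<le> \<bar>W \<omega> - expectation W\<bar>}"
      by (rule finite_measure_mono) (auto simp: assms(3))
    also have "\<dots> \<le> variance W / (c * sqrt ?V)\<^sup>2"
      by (rule Chebyshev_inequality) (use assms V in auto)
    also have "\<dots> = 1 / c\<^sup>2"
      using V assms(3,4) by (simp add: power_mult_distrib)
    finally show ?thesis .
  qed
qed

text \<open>The conditional probability of an event independent of \<open>Y\<close> is almost surely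
  constant, because the constant \<open>prob A\<close> has the right average over every preimage
  under \<open>Y\<close>; monotonicity passes to \<open>P\<close>. The detour through
  \<open>A\<close> allows \<open>P\<close> itself to depend on \<open>Y\<close>.\<close>

lemma (in prob_space) cond_prob_given_ge_prob:
  fixes Y :: "'a \<Rightarrow> 'y::topological_space"
  assumes [measurable]: "Y \<in> borel_measurable M" "A \<in> events" "{\<omega> \<in> space M. P \<omega>} \<in> events"
    and A: "A \<subseteq> {\<omega> \<in> space M. P \<omega>}"
    and indep: "\<And>B. B \<in> sets borel \<Longrightarrow> prob (A \<inter> {\<omega> \<in> space M. Y \<omega> \<in> B}) = prob A * prob {\<omega> \<in> space M. Y \<omega> \<in> B}"
  shows "AE \<omega> in M. prob A \<le> cond_prob_given M Y P \<omega>"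
proof -
  let ?F = "vimage_algebra (space M) Y borel"
  have sF: "sets ?F = {Y -` B \<inter> space M |B. B \<in> sets borel}"
    by (rule sets_vimage_algebra2) simp
  have "subalgebra M ?F"
    by (auto simp: subalgebra_def sF)
  then interpret F: finite_measure_subalgebra M ?F
    by unfold_locales
  have int: "integrable M (indicator C :: 'a \<Rightarrow> real)" if "C \<in> events" for C
    using that by (simp add: integrable_indicator_iff emeasure_eq_measure)
  have "AE \<omega> in M. real_cond_exp M ?F (indicator A) \<omega> = prob A"
  proof (rule F.real_cond_exp_charact)
    fix C assume "C \<in> sets ?F"
    then obtain B where B: "B \<in> sets borel" "C = {\<omega> \<in> space M. Y \<omega> \<in> B}"
      by (auto simp: sF)
    then have [measurable]: "C \<in> events" by simp
    have "(\<integral>\<omega>\<in>C. indicator A \<omega> \<partial>M) = prob (A \<inter> C)"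
      by (simp add: set_lebesgue_integral_def indicator_inter_arith[symmetric] Int_commute)
    also have "\<dots> = prob A * prob C" using indep B by simp
    also have "\<dots> = (\<integral>\<omega>\<in>C. prob A \<partial>M)"
      by (simp add: set_lebesgue_integral_def)
    finally show "(\<integral>\<omega>\<in>C. indicator A \<omega> \<partial>M) = (\<integral>\<omega>\<in>C. prob A \<partial>M)" .
  qed (simp_all add: int)
  moreover have "AE \<omega> in M. real_cond_exp M ?F (indicator A) \<omega> \<le> real_cond_exp M ?F (indicator {\<omega> \<in> space M. P \<omega>}) \<omega>"
    using A by (intro F.real_cond_exp_mono int) (auto simp: indicator_def)
  ultimately show ?thesis
    unfolding cond_prob_given_def by eventually_elim simp
qed

section \<open>Measurability, and independence of the vector prediction error from the data\<close>

lemma borel_measurable_vec_lambda: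
  fixes f :: "'i::finite \<Rightarrow> 'a \<Rightarrow> 'b::euclidean_space"
  assumes "\<And>i. f i \<in> borel_measurable M"
  shows "(\<lambda>\<omega>. \<chi> i. f i \<omega>) \<in> borel_measurable M"
proof (rule borel_measurable_euclidean_space[THEN iffD2], rule ballI)
  fix b :: "'b ^ 'i" assume "b \<in> Basis"
  then obtain i c where b: "b = axis i c" by (auto simp: Basis_vec_def)
  show "(\<lambda>\<omega>. (\<chi> i. f i \<omega>) \<bullet> b) \<in> borel_measurable M"
    unfolding b inner_axis vec_lambda_beta
    by (intro borel_measurable_inner assms borel_measurable_const)
qed

lemma borel_measurable_posterior_mean:
  assumes "y \<in> borel_measurable M"
  shows "(\<lambda>\<omega>. posterior_mean m k Z (y \<omega>) z) \<in> borel_measurable M"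
proof -
  have "continuous_on UNIV (\<lambda>x. posterior_mean m k Z x z)"
    unfolding posterior_mean_def dot_lmul_matrix[symmetric]
    by (intro continuous_intros)
  from borel_measurable_continuous_on[OF this assms] show ?thesis .
qed

text \<open>Independence of the components makes the joint characteristic function of error and data
  a product of the factors from \<open>prediction_error\<close>. Each exponent is a term in
  \<open>s\<close> plus a term in \<open>t\<close>, so the product splits and Kac's criterion
  applies.\<close>

lemma (in prob_space) prediction_error_indep_data:
  fixes vu :: "'a \<Rightarrow> 'z \<Rightarrow> real ^ 'd::finite" and Z :: "'N::finite \<Rightarrow> 'z"
  assumes vgp: "vector_gaussian_process M vu m k"
    and inv: "\<And>i. invertible (gram_matrix (k i) Z)"
    and A[measurable]: "A \<in> sets borel" and B[measurable]: "B \<in> sets borel"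
  shows "prob {\<omega> \<in> space M. vu \<omega> z - posterior_mean_vec m k Z (vu \<omega>) z \<in> A \<and> (\<chi> j. vu \<omega> (Z j)) \<in> B} =
    prob {\<omega> \<in> space M. vu \<omega> z - posterior_mean_vec m k Z (vu \<omega>) z \<in> A} * prob {\<omega> \<in> space M. (\<chi> j. vu \<omega> (Z j)) \<in> B}"
proof -
  have gp: "gaussian_process M (\<lambda>\<omega> z. vu \<omega> z $ i) (m i) (k i)" for i
    using vgp by (simp add: vector_gaussian_process_def)
  note gm[measurable] = gaussian_process_measurable[OF gp]
  define R where "R i \<omega> = vu \<omega> z $ i - posterior_mean (m i) (k i) Z (\<chi> j. vu \<omega> (Z j) $ i) z" for i \<omega>
  define y where "y i \<omega> = (\<chi> j. vu \<omega> (Z j) $ i - m i (Z j))" for i \<omega>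
  define X where "X \<omega> = (\<chi> i. R i \<omega>)" for \<omega>
  define Yc where "Yc \<omega> = (\<chi> j. \<chi> i. vu \<omega> (Z j) $ i - m i (Z j))" for \<omega>
  \<comment> \<open>The part of the frequency \<open>t\<close> that is paired with the data of
    component \<open>i\<close>.\<close>
  define col where "col t i = (\<chi> j. t $ j $ i)" for t :: "real^'d^'N" and i
  define y0 where "y0 = (\<chi> j. \<chi> i. m i (Z j))"
  have X_eq: "vu \<omega> z - posterior_mean_vec m k Z (vu \<omega>) z = X \<omega>" for \<omega>
    by (simp add: X_def R_def posterior_mean_vec_def vec_eq_iff)
  have Y_eq: "(\<chi> j. vu \<omega> (Z j)) = Yc \<omega> + y0" for \<omega>
    by (simp add: Yc_def y0_def vec_eq_iff)
  have [measurable]: "R i \<in> borel_measurable M" "y i \<in> borel_measurable M" for i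
    unfolding R_def[abs_def] y_def[abs_def]
    by (intro borel_measurable_diff borel_measurable_posterior_mean borel_measurable_vec_lambda gm borel_measurable_const)+
  have X[measurable]: "X \<in> borel_measurable M"
    unfolding X_def[abs_def] by (rule borel_measurable_vec_lambda) measurable
  have Yc[measurable]: "Yc \<in> borel_measurable M"
    unfolding Yc_def[abs_def] by (intro borel_measurable_vec_lambda) measurable
  define W where "W s t i \<omega> = s $ i * R i \<omega> + col t i \<bullet> y i \<omega>" for s :: "real^'d" and t i \<omega>
  have sum_W: "s \<bullet> X \<omega> + t \<bullet> Yc \<omega> = (\<Sum>i\<in>UNIV. W s t i \<omega>)" for s t \<omega>
    unfolding W_def sum.distrib
    by (simp add: inner_vec_def X_def Yc_def y_def col_def) (rule sum.swap)
  have indep: "indep_vars (\<lambda>i. borel) (W s t) UNIV" for s t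
  proof -
    \<comment> \<open>\<open>H i\<close> expresses \<open>W s t i\<close> as a measurable functional
      of the whole path of component \<open>i\<close>, so independence of the processes carries
      over.\<close>
    define H where "H i \<phi> = s $ i * (\<phi> z - posterior_mean (m i) (k i) Z (\<chi> j. \<phi> (Z j)) z)
        + col t i \<bullet> (\<chi> j. \<phi> (Z j) - m i (Z j))" for i and \<phi> :: "'z \<Rightarrow> real"
    have c: "(\<lambda>\<phi>. \<phi> x) \<in> borel_measurable (Pi\<^sub>M UNIV (\<lambda>x. borel :: real measure))" for x :: 'z
      by simp
    have H: "H i \<in> borel_measurable (Pi\<^sub>M UNIV (\<lambda>x. borel))" for i
    proof -
      have 1: "(\<lambda>\<phi>. posterior_mean (m i) (k i) Z (\<chi> j. \<phi> (Z j)) z) \<in> borel_measurable (Pi\<^sub>M UNIV (\<lambda>x. borel))"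
        by (rule borel_measurable_posterior_mean[OF borel_measurable_vec_lambda[OF c]])
      have 2: "(\<lambda>\<phi>. \<chi> j. \<phi> (Z j) - m i (Z j)) \<in> borel_measurable (Pi\<^sub>M UNIV (\<lambda>x. borel))"
        by (rule borel_measurable_vec_lambda[OF borel_measurable_diff[OF c borel_measurable_const]])
      show ?thesis
        unfolding H_def[abs_def]
        by (rule borel_measurable_add[OF borel_measurable_times[OF borel_measurable_const
              borel_measurable_diff[OF c 1]] borel_measurable_inner[OF borel_measurable_const 2]])
    qed
    have "indep_vars (\<lambda>i. Pi\<^sub>M UNIV (\<lambda>z. borel)) (\<lambda>i \<omega> z. vu \<omega> z $ i) UNIV"
      using vgp by (simp add: vector_gaussian_process_def)
    from indep_vars_compose2[OF this H]
    have "indep_vars (\<lambda>i. borel) (\<lambda>i \<omega>. H i (\<lambda>z. vu \<omega> z $ i)) UNIV" .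
    then show ?thesis
      by (simp add: H_def W_def[abs_def] R_def y_def)
  qed
  have char: "(CLINT \<omega>|M. iexp (s \<bullet> X \<omega> + t \<bullet> Yc \<omega>)) =
      (\<Prod>i\<in>UNIV. exp (- complex_of_real ((s $ i)\<^sup>2 * posterior_var (k i) Z z + col t i \<bullet> (gram_matrix (k i) Z *v col t i)) / 2))"
    for s t
  proof -
    have [measurable]: "W s t i \<in> borel_measurable M" for i
      unfolding W_def[abs_def] by measurable
    \<comment> \<open>Reading these integrals as characteristic functions at \<open>1\<close> makes
      the product rule for sums of independent variables applicable.\<close>
    have 1: "char (distr M borel g) 1 = (CLINT \<omega>|M. iexp (g \<omega>))" if [measurable]: "g \<in> borel_measurable M" for g
      by (simp add: char_def integral_distr)
    have "(CLINT \<omega>|M. iexp (s \<bullet> X \<omega> + t \<bullet> Yc \<omega>)) = char (distr M borel (\<lambda>\<omega>. \<Sum>i\<in>UNIV. W s t i \<omega>)) 1"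
      unfolding sum_W by (subst 1) auto
    also have "\<dots> = (\<Prod>i\<in>UNIV. CLINT \<omega>|M. iexp (W s t i \<omega>))"
      unfolding char_distr_sum[OF indep] by (intro prod.cong 1) auto
    also have "\<dots> = (\<Prod>i\<in>UNIV. exp (- complex_of_real ((s $ i)\<^sup>2 * posterior_var (k i) Z z + col t i \<bullet> (gram_matrix (k i) Z *v col t i)) / 2))"
      unfolding W_def R_def y_def by (intro prod.cong refl prediction_error(4)[OF gp inv])
    finally show ?thesis .
  qed
  \<comment> \<open>The data are the centred data shifted by the constant \<open>y0\<close>, so the
    event \<open>B\<close> is shifted back.\<close>
  have "prob {\<omega> \<in> space M. X \<omega> \<in> A \<and> Yc \<omega> \<in> (\<lambda>x. x + y0) -` B} =
    prob {\<omega> \<in> space M. X \<omega> \<in> A} * prob {\<omega> \<in> space M. Yc \<omega> \<in> (\<lambda>x. x + y0) -` B}"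
  proof (rule indep_if_char_product[OF X Yc])
    have col0: "col 0 i = 0" for i by (simp add: col_def vec_eq_iff)
    show "(CLINT \<omega>|M. iexp (s \<bullet> X \<omega> + t \<bullet> Yc \<omega>)) = (CLINT \<omega>|M. iexp (s \<bullet> X \<omega>)) * (CLINT \<omega>|M. iexp (t \<bullet> Yc \<omega>))" for s t
      using char[of s t] char[of s 0] char[of 0 t]
      by (simp add: col0 prod.distrib[symmetric] exp_add[symmetric] add_divide_distrib diff_divide_distrib)
    show "(\<lambda>x. x + y0) -` B \<in> sets borel"
      by (rule measurable_sets_borel[OF _ B]) measurable
  qed simp
  then show ?thesis by (simp add: X_eq Y_eq)
qed

section \<open>The error bound for the projected prediction\<close>

text \<open>Where all standard deviations vanish, the right-hand side is \<open>0\<close> and a norm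
  cannot lie strictly below it; there the bound is stated with \<open>\<le>\<close>. The constant
  \<open>\<gamma>\<close> is chosen before \<open>z\<close>, while the probability is taken for each
  \<open>z\<close> separately.\<close>

theorem theorem1:
  fixes M :: "'w measure"
    and vu :: "'w \<Rightarrow> 'n::finite state \<Rightarrow> real ^ 'd::finite"
    and m :: "'d \<Rightarrow> 'n state \<Rightarrow> real"
    and k :: "'d \<Rightarrow> 'n state \<Rightarrow> 'n state \<Rightarrow> real"
    and Z :: "'N::finite \<Rightarrow> 'n state"
    and g :: "real ^ 'd \<Rightarrow> real ^ 'c::finite"
    and v :: "real ^ 'd \<Rightarrow> real ^ 'd"
    and L :: real
  assumes "prob_space M"
    and "vector_gaussian_process M vu m k"
    and "\<And>i. invertible (gram_matrix (k i) Z)"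
    and "\<And>u. projection_argmin g u = {v u}"
    and "L-lipschitz_on UNIV v"
  shows "\<forall>\<delta>. 0 < \<delta> \<and> \<delta> < 1 \<longrightarrow> (\<exists>\<gamma>>0. \<forall>z.
    ((\<exists>i. posterior_sd (k i) Z z \<noteq> 0) \<longrightarrow>
      (AE \<omega> in M. cond_prob_given M (\<lambda>\<omega>. \<chi> j. vu \<omega> (Z j))
        (\<lambda>\<omega>. norm (v (vu \<omega> z) - v (posterior_mean_vec m k Z (vu \<omega>) z))
               < (\<Sum>i\<in>UNIV. \<gamma> * posterior_sd (k i) Z z)) \<omega> \<ge> 1 - \<delta>)) \<and>
    ((\<forall>i. posterior_sd (k i) Z z = 0) \<longrightarrow>
      (AE \<omega> in M. cond_prob_given M (\<lambda>\<omega>. \<chi> j. vu \<omega> (Z j))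
        (\<lambda>\<omega>. norm (v (vu \<omega> z) - v (posterior_mean_vec m k Z (vu \<omega>) z))
               \<le> (\<Sum>i\<in>UNIV. \<gamma> * posterior_sd (k i) Z z)) \<omega> \<ge> 1 - \<delta>)))"
proof (intro allI impI)
  fix \<delta> :: real assume \<delta>: "0 < \<delta> \<and> \<delta> < 1"
  interpret prob_space M by fact
  have gp: "gaussian_process M (\<lambda>\<omega> z. vu \<omega> z $ i) (m i) (k i)" for i
    using assms(2) by (simp add: vector_gaussian_process_def)
  note gm = gaussian_process_measurable[OF gp]
  have L: "0 \<le> L" using assms(5) by (rule lipschitz_on_nonneg)
  have "continuous_on UNIV v" using assms(5) by (rule lipschitz_on_continuous_on)
  then have v_meas[measurable]: "v \<in> borel_measurable borel" by (rule borel_measurable_continuous_onI)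
  \<comment> \<open>Each of the \<open>CARD('d)\<close> components may fail with probability at most
    \<open>\<delta> / CARD('d)\<close>, which Chebyshev's bound \<open>1 / c\<^sup>2\<close> attains
    for this \<open>c\<close>.\<close>
  define c where "c = sqrt (real CARD('d) / \<delta>)"
  have c: "0 < c" "1 / c\<^sup>2 = \<delta> / real CARD('d)"
    using \<delta> by (simp_all add: c_def)
  define \<gamma> where "\<gamma> = c * (L + 1)"
  have "\<gamma> > 0" using c L by (simp add: \<gamma>_def)
  moreover have "((\<exists>i. posterior_sd (k i) Z z \<noteq> 0) \<longrightarrow>
      (AE \<omega> in M. cond_prob_given M (\<lambda>\<omega>. \<chi> j. vu \<omega> (Z j))
        (\<lambda>\<omega>. norm (v (vu \<omega> z) - v (posterior_mean_vec m k Z (vu \<omega>) z))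
               < (\<Sum>i\<in>UNIV. \<gamma> * posterior_sd (k i) Z z)) \<omega> \<ge> 1 - \<delta>)) \<and>
    ((\<forall>i. posterior_sd (k i) Z z = 0) \<longrightarrow>
      (AE \<omega> in M. cond_prob_given M (\<lambda>\<omega>. \<chi> j. vu \<omega> (Z j))
        (\<lambda>\<omega>. norm (v (vu \<omega> z) - v (posterior_mean_vec m k Z (vu \<omega>) z))
               \<le> (\<Sum>i\<in>UNIV. \<gamma> * posterior_sd (k i) Z z)) \<omega> \<ge> 1 - \<delta>))" for z
  proof -
    define E where "E \<omega> = vu \<omega> z - posterior_mean_vec m k Z (vu \<omega>) z" for \<omega>
    define sd where "sd i = posterior_sd (k i) Z z" for i
    have E_nth: "E \<omega> $ i = vu \<omega> z $ i - posterior_mean (m i) (k i) Z (\<chi> j. vu \<omega> (Z j) $ i) z" for \<omega> i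
      by (simp add: E_def posterior_mean_vec_def)
    note err = prediction_error[OF gp assms(3), where z = z, folded E_nth]
    \<comment> \<open>Being a second moment of the error, the posterior variance is nonnegative, so
      its square root is a genuine standard deviation.\<close>
    have sd_eq: "sd i = sqrt (expectation (\<lambda>\<omega>. (E \<omega> $ i)\<^sup>2))" for i
      by (simp add: sd_def posterior_sd_def err(3))
    have sd_nonneg: "0 \<le> sd i" for i by (simp add: sd_eq)
    have vec[measurable]: "(\<lambda>\<omega>. vu \<omega> x) \<in> borel_measurable M" for x
      using borel_measurable_vec_lambda[of "\<lambda>i \<omega>. vu \<omega> x $ i" M, OF gm] by simp
    have [measurable]: "(\<lambda>\<omega>. posterior_mean_vec m k Z (vu \<omega>) z) \<in> borel_measurable M"
      unfolding posterior_mean_vec_def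
      by (intro borel_measurable_vec_lambda borel_measurable_posterior_mean gm)
    have [measurable]: "E \<in> borel_measurable M" unfolding E_def[abs_def] by measurable
    have [measurable]: "(\<lambda>x. x $ i) \<in> borel_measurable (borel :: (real^'d) measure)" for i
      by (intro borel_measurable_continuous_onI continuous_intros)
    define B where "B = {x :: real^'d. \<forall>i. \<bar>x $ i\<bar> \<le> c * sd i}"
    have [measurable]: "B \<in> sets borel" unfolding B_def by measurable
    \<comment> \<open>This event is expressed by the error alone, hence independent of the data; the
      event in the claim also involves the posterior mean.\<close>
    define A where "A = {\<omega> \<in> space M. E \<omega> \<in> B}"
    have [measurable]: "A \<in> events" unfolding A_def by measurable
    have "prob (space M - A) \<le> prob (\<Union>i\<in>UNIV. {\<omega> \<in> space M. c * sd i < \<bar>E \<omega> $ i\<bar>})"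
      by (rule finite_measure_mono) (auto simp: A_def B_def not_le)
    also have "\<dots> \<le> (\<Sum>i\<in>UNIV. prob {\<omega> \<in> space M. c * sd i < \<bar>E \<omega> $ i\<bar>})"
      by (rule finite_measure_subadditive_finite) auto
    also have "\<dots> \<le> (\<Sum>i\<in>(UNIV :: 'd set). 1 / c\<^sup>2)"
      unfolding sd_eq by (intro sum_mono prob_abs_gt_multiple_sd_le) (use err c in auto)
    also have "\<dots> = \<delta>" unfolding c by simp
    finally have probA: "1 - \<delta> \<le> prob A" by (simp add: prob_compl)
    have bound: "norm (v (vu \<omega> z) - v (posterior_mean_vec m k Z (vu \<omega>) z)) \<le> L * c * (\<Sum>i\<in>UNIV. sd i)" if "\<omega> \<in> A" for \<omega>
    proof -
      have "norm (v (vu \<omega> z) - v (posterior_mean_vec m k Z (vu \<omega>) z)) \<le> L * norm (E \<omega>)"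
        using lipschitz_onD[OF assms(5), of "vu \<omega> z" "posterior_mean_vec m k Z (vu \<omega>) z"]
        by (simp add: dist_norm E_def)
      also have "\<dots> \<le> L * (\<Sum>i\<in>UNIV. \<bar>E \<omega> $ i\<bar>)"
        by (intro mult_left_mono norm_le_l1_cart L)
      also have "\<dots> \<le> L * (\<Sum>i\<in>UNIV. c * sd i)"
        using that by (intro mult_left_mono sum_mono L) (auto simp: A_def B_def)
      finally show ?thesis by (simp add: sum_distrib_left mult.assoc)
    qed
    \<comment> \<open>The summand \<open>1\<close> in \<open>\<gamma>\<close> contributes
      \<open>c * (\<Sum>i\<in>UNIV. sd i)\<close> beyond the Lipschitz bound; this gap is positive
      as soon as one standard deviation is.\<close>
    have sum_eq: "(\<Sum>i\<in>UNIV. \<gamma> * posterior_sd (k i) Z z) = L * c * (\<Sum>i\<in>UNIV. sd i) + c * (\<Sum>i\<in>UNIV. sd i)"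
      unfolding \<gamma>_def sd_def by (simp only: sum_distrib_left[symmetric]) (simp add: algebra_simps)
    have "prob (A \<inter> {\<omega> \<in> space M. (\<chi> j. vu \<omega> (Z j)) \<in> C}) = prob A * prob {\<omega> \<in> space M. (\<chi> j. vu \<omega> (Z j)) \<in> C}"
      if "C \<in> sets borel" for C
    proof -
      have "A \<inter> {\<omega> \<in> space M. (\<chi> j. vu \<omega> (Z j)) \<in> C} = {\<omega> \<in> space M. E \<omega> \<in> B \<and> (\<chi> j. vu \<omega> (Z j)) \<in> C}"
        by (auto simp: A_def)
      then show ?thesis
        using prediction_error_indep_data[OF assms(2,3) \<open>B \<in> sets borel\<close> that, where z=z] by (simp add: A_def E_def)
    qed
    note cond = cond_prob_given_ge_prob[OF borel_measurable_vec_lambda[OF vec] \<open>A \<in> events\<close> _ _ this]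
    show ?thesis
    proof (intro conjI impI)
      assume "\<exists>i. posterior_sd (k i) Z z \<noteq> 0"
      then have "0 < (\<Sum>i\<in>UNIV. sd i)"
        using sd_nonneg by (metis UNIV_I finite less_eq_real_def sd_def sum_pos2)
      then have "AE \<omega> in M. prob A \<le> cond_prob_given M (\<lambda>\<omega>. \<chi> j. vu \<omega> (Z j))
        (\<lambda>\<omega>. norm (v (vu \<omega> z) - v (posterior_mean_vec m k Z (vu \<omega>) z))
               < (\<Sum>i\<in>UNIV. \<gamma> * posterior_sd (k i) Z z)) \<omega>"
        using c by (intro cond) (auto simp: sum_eq A_def intro!: le_less_trans[OF bound])
      then show "AE \<omega> in M. cond_prob_given M (\<lambda>\<omega>. \<chi> j. vu \<omega> (Z j))
        (\<lambda>\<omega>. norm (v (vu \<omega> z) - v (posterior_mean_vec m k Z (vu \<omega>) z))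
               < (\<Sum>i\<in>UNIV. \<gamma> * posterior_sd (k i) Z z)) \<omega> \<ge> 1 - \<delta>"
        by eventually_elim (use probA in simp)
    next
      have "0 \<le> (\<Sum>i\<in>UNIV. sd i)" by (intro sum_nonneg sd_nonneg)
      then have "AE \<omega> in M. prob A \<le> cond_prob_given M (\<lambda>\<omega>. \<chi> j. vu \<omega> (Z j))
        (\<lambda>\<omega>. norm (v (vu \<omega> z) - v (posterior_mean_vec m k Z (vu \<omega>) z))
               \<le> (\<Sum>i\<in>UNIV. \<gamma> * posterior_sd (k i) Z z)) \<omega>"
        using c by (intro cond) (auto simp: sum_eq A_def intro!: order_trans[OF bound])
      then show "AE \<omega> in M. cond_prob_given M (\<lambda>\<omega>. \<chi> j. vu \<omega> (Z j))
        (\<lambda>\<omega>. norm (v (vu \<omega> z) - v (posterior_mean_vec m k Z (vu \<omega>) z))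
               \<le> (\<Sum>i\<in>UNIV. \<gamma> * posterior_sd (k i) Z z)) \<omega> \<ge> 1 - \<delta>"
        by eventually_elim (use probA in simp)
    qed
  qed
  ultimately show "\<exists>\<gamma>>0. \<forall>z.
    ((\<exists>i. posterior_sd (k i) Z z \<noteq> 0) \<longrightarrow>
      (AE \<omega> in M. cond_prob_given M (\<lambda>\<omega>. \<chi> j. vu \<omega> (Z j))
        (\<lambda>\<omega>. norm (v (vu \<omega> z) - v (posterior_mean_vec m k Z (vu \<omega>) z))
               < (\<Sum>i\<in>UNIV. \<gamma> * posterior_sd (k i) Z z)) \<omega> \<ge> 1 - \<delta>)) \<and>
    ((\<forall>i. posterior_sd (k i) Z z = 0) \<longrightarrow>
      (AE \<omega> in M. cond_prob_given M (\<lambda>\<omega>. \<chi> j. vu \<omega> (Z j))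
        (\<lambda>\<omega>. norm (v (vu \<omega> z) - v (posterior_mean_vec m k Z (vu \<omega>) z))
               \<le> (\<Sum>i\<in>UNIV. \<gamma> * posterior_sd (k i) Z z)) \<omega> \<ge> 1 - \<delta>))"
    by blast
qed

end
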